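(* Let $\{\lambda(X_v)^{-1}T_v\}_{v\in\mathbb{T}}$ be a doubly stochastic Yule (DSY) cascade of type $(\mathcal{M})$ with state space $(S,\mathcal{S})$ and one-step transition probability $p(x,dy)$, such that along each path $s\in\partial\mathbb{T}$ the Markov process $X_{s|0},X_{s|1},X_{s|2},\dots$ is time-reversible with respect to an invariant probability measure $\gamma$. For $a>0$ let $T_a:L^2(\gamma)\to L^2(\gamma)$ be the operator $$T_af(x)=\frac{\lambda(x)}{a+\lambda(x)}\int_S f(y)\,p(x,dy).$$ Suppose that for some $a>0$, $$\limsup_{n\to\infty}\sqrt[n]{\langle 1,T_a^n1\rangle_\gamma}<\frac12 .$$ Then: (a) for $\gamma$-a.e. $x\in S$, the cascade is non-explosive for initial state $X_\theta=x$; (b) if, in addition, $p(x_0,dy)\ll\gamma(dy)$ for some $x_0\in S$, then the cascade associated with the initial state $X_\theta=x_0$ is non-explosive.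
   Context: Tree. $\mathbb{T}=\{\theta\}\cup\bigcup_{n\ge1}\{1,2\}^n$ is the full infinite binary tree with root $\theta$; $\partial\mathbb{T}=\{1,2\}^\infty$. For $s\in\partial\mathbb{T}$, $s|n=(s_1,\dots,s_n)$ for $n\ge1$ and $s|0=\theta$. A vertex $v=s|n$ has height $|v|=n$, and $v|j$ ($0\le j\le |v|$) denotes its ancestor of height $j$, with $v|0=\theta$. DSY cascade. $\{T_v\}_{v\in\mathbb{T}}$ is a family of i.i.d. mean-one exponential random variables. A DSY cascade is a family $\{\lambda_v^{-1}T_v\}_{v\in\mathbb{T}}$, where $\{\lambda_v\}_{v\in\mathbb{T}}$ is a family of positive random variables independent of $\{T_v\}_{v\in\mathbb{T}}$. Type $(\mathcal{M})$. The cascade is of type $(\mathcal{M})$ if $\lambda_v=\lambda(X_v)$, where $\lambda:S\to(0,\infty)$ is a measurable function and $\{X_v\}_{v\in\mathbb{T}}$ is a family of random variables such that: (A) for every path $s\in\partial\mathbb{T}$, $X_{s|0},X_{s|1},X_{s|2},\dots$ is a time-homogeneous Markov chain on a measurable space $(S,\mathcal{S})$; (B) the transition probability $p(x,dy)$ of this chain does not depend on $s$. Initial state. "The cascade for (associated with) initial state $X_\theta=x$" means the type $(\mathcal{M})$ DSY cascade with the same $\lambda$ and $p$ and with $X_\theta=x$ almost surely. Explosion. The explosion time is the $[0,\infty]$-valued random variable $\zeta=\sup_{n\ge0}\min_{|v|=n}\sum_{j=0}^n \frac{T_{v|j}}{\lambda_{v|j}}$. The cascade is non-explosive if $\mathbb{P}(\zeta=\infty)=1$.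 Time-reversibility with respect to $\gamma$ means $\gamma(dx)p(x,dy)=\gamma(dy)p(y,dx)$ as measures on $S\times S$. $\langle\cdot,\cdot\rangle_\gamma$ is the inner product of $L^2(\gamma)$ and $1$ is the constant function. *)

theory Defs
  imports "HOL-Probability.Probability"
begin

text \<open>
  The full binary tree: a vertex of height \<open>n\<close> is a list of length \<open>n\<close> over the two-element
  alphabet \<open>bool\<close> (standing for \<open>{1,2}\<close>), whose first entry is the choice made at the root.
  The root is \<open>[]\<close>, and the ancestor of \<open>v\<close> of height \<open>j\<close> is \<open>take j v\<close>.
\<close>

type_synonym vertex = "bool list"

definition path_vertex :: "(nat \<Rightarrow> bool) \<Rightarrow> nat \<Rightarrow> vertex" where
  "path_vertex s n = map s [0..<n]"

definition dsy_cascade ::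
  "'w measure \<Rightarrow> (vertex \<Rightarrow> 'w \<Rightarrow> real) \<Rightarrow> (vertex \<Rightarrow> 'w \<Rightarrow> real) \<Rightarrow> bool" where
  "dsy_cascade M L T \<longleftrightarrow>
     prob_space M \<and>
     prob_space.indep_vars M (\<lambda>_. borel) T UNIV \<and>
     (\<forall>v. distributed M lborel (T v) (exponential_density 1)) \<and>
     (\<forall>v. L v \<in> borel_measurable M \<and> (\<forall>\<omega>\<in>space M. 0 < L v \<omega>)) \<and>
     prob_space.indep_var M
       (PiM UNIV (\<lambda>_. borel)) (\<lambda>\<omega> v. L v \<omega>)
       (PiM UNIV (\<lambda>_. borel)) (\<lambda>\<omega> v. T v \<omega>)"

text \<open>
  \<open>T\<close> is real-valued and only almost surely nonnegative, so the explosion time is taken in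
  \<^typ>\<open>ereal\<close>; it lies in \<open>[0,\<infinity>]\<close> almost surely.
\<close>

definition explosion_time ::
  "(vertex \<Rightarrow> 'w \<Rightarrow> real) \<Rightarrow> (vertex \<Rightarrow> 'w \<Rightarrow> real) \<Rightarrow> 'w \<Rightarrow> ereal" where
  "explosion_time L T \<omega> =
     (SUP n. ereal (MIN v\<in>{v. length v = n}. \<Sum>j=0..n. T (take j v) \<omega> / L (take j v) \<omega>))"

definition non_explosive ::
  "'w measure \<Rightarrow> (vertex \<Rightarrow> 'w \<Rightarrow> real) \<Rightarrow> (vertex \<Rightarrow> 'w \<Rightarrow> real) \<Rightarrow> bool" where
  "non_explosive M L T \<longleftrightarrow> \<P>(\<omega> in M. explosion_time L T \<omega> = \<infinity>) = 1"

definition history :: "'w measure \<Rightarrow> 'a measure \<Rightarrow> (nat \<Rightarrow> 'w \<Rightarrow> 'a) \<Rightarrow> nat \<Rightarrow> 'w measure" where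
  "history M S Y n = sigma (space M) (\<Union>i\<le>n. {Y i -` A \<inter> space M | A. A \<in> sets S})"

definition markov_chain ::
  "'w measure \<Rightarrow> 'a measure \<Rightarrow> ('a \<Rightarrow> 'a measure) \<Rightarrow> (nat \<Rightarrow> 'w \<Rightarrow> 'a) \<Rightarrow> bool" where
  "markov_chain M S p Y \<longleftrightarrow>
     (\<forall>n. Y n \<in> M \<rightarrow>\<^sub>M S) \<and>
     (\<forall>n. \<forall>A\<in>sets S. AE \<omega> in M.
        real_cond_exp M (history M S Y n) (indicator (Y (Suc n) -` A \<inter> space M)) \<omega>
          = measure (p (Y n \<omega>)) A)"

text \<open>
  Only the laws along individual paths are prescribed, with a transition kernel \<open>p\<close> that is the
  same for all of them; the joint law of the \<open>X v\<close> across different paths is left free.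
\<close>

definition dsy_cascade_type_M ::
  "'w measure \<Rightarrow> 'a measure \<Rightarrow> ('a \<Rightarrow> 'a measure) \<Rightarrow> ('a \<Rightarrow> real) \<Rightarrow>
   (vertex \<Rightarrow> 'w \<Rightarrow> 'a) \<Rightarrow> (vertex \<Rightarrow> 'w \<Rightarrow> real) \<Rightarrow> bool" where
  "dsy_cascade_type_M M S p lam X T \<longleftrightarrow>
     dsy_cascade M (\<lambda>v \<omega>. lam (X v \<omega>)) T \<and>
     (\<forall>s. markov_chain M S p (\<lambda>n. X (path_vertex s n)))"

text \<open>The measure \<open>\<gamma>(dx) p(x,dy)\<close> on \<open>S \<times> S\<close>.\<close>

definition pair_law :: "'a measure \<Rightarrow> 'a measure \<Rightarrow> ('a \<Rightarrow> 'a measure) \<Rightarrow> ('a \<times> 'a) measure" where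
  "pair_law S \<gamma> p = \<gamma> \<bind> (\<lambda>x. p x \<bind> (\<lambda>y. return (S \<Otimes>\<^sub>M S) (x, y)))"

definition time_reversible :: "'a measure \<Rightarrow> 'a measure \<Rightarrow> ('a \<Rightarrow> 'a measure) \<Rightarrow> bool" where
  "time_reversible S \<gamma> p \<longleftrightarrow>
     pair_law S \<gamma> p = distr (pair_law S \<gamma> p) (S \<Otimes>\<^sub>M S) (\<lambda>(x, y). (y, x))"

definition invariant_measure :: "'a measure \<Rightarrow> ('a \<Rightarrow> 'a measure) \<Rightarrow> bool" where
  "invariant_measure \<gamma> p \<longleftrightarrow> \<gamma> \<bind> p = \<gamma>"

text \<open>
  Elements of \<open>L\<^sup>2(\<gamma>)\<close> are represented by functions; for \<open>f \<in> L\<^sup>2(\<gamma>)\<close> and invariant \<open>\<gamma>\<close> the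
  integral below exists for \<open>\<gamma>\<close>-almost every \<open>x\<close>.
\<close>

definition T_op :: "('a \<Rightarrow> 'a measure) \<Rightarrow> ('a \<Rightarrow> real) \<Rightarrow> real \<Rightarrow> ('a \<Rightarrow> real) \<Rightarrow> 'a \<Rightarrow> real" where
  "T_op p lam a f x = lam x / (a + lam x) * (\<integral>y. f y \<partial>p x)"

definition L2_inner :: "'a measure \<Rightarrow> ('a \<Rightarrow> real) \<Rightarrow> ('a \<Rightarrow> real) \<Rightarrow> real" where
  "L2_inner \<gamma> f g = (\<integral>x. f x * g x \<partial>\<gamma>)"

end

theory Submission imports Defs begin

text \<open>
  Discounting at rate \<open>a\<close> turns explosion into a first-moment question. For a vertex \<open>v\<close> let
  \<open>S\<^sub>v\<close> be the time accumulated along the path from the root to \<open>v\<close>. If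
  \<open>\<Sum>\<^sub>v exp (- a S\<^sub>v)\<close> converges, then the sum over level \<open>n\<close> tends to \<open>0\<close>, hence so does its
  largest term, the minimum of \<open>S\<^sub>v\<close> over level \<open>n\<close> tends to infinity, and there is no explosion
  (\<open>explosion_time_eq_infinity\<close>).

  Given the intensities, the clocks are independent exponentials, so the conditional mean of
  \<open>exp (- a S\<^sub>v)\<close> is the product of \<open>\<lambda> / (a + \<lambda>)\<close> along the path. This is the probability that
  the path outlives an independent killing at rate \<open>a\<close>. It therefore suffices that these products,
  which depend on the intensities alone, have an almost surely finite sum over the tree
  (\<open>non_explosive_if_summable_survival_weights\<close>).

  Along a single path the Markov property evaluates the mean of the product over \<open>n\<close> consecutive
  vertices, given the state \<open>y\<close> at the first of them, as \<open>(T\<^sub>a)\<^sup>n 1 (y)\<close>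
  (\<open>expectation_path_product\<close>). With \<open>2\<^sup>n\<close> paths the quantity that matters is
  \<open>F y = \<Sum>n\<ge>1. 2\<^sup>n (T\<^sub>a)\<^sup>n 1 (y)\<close>, and the spectral assumption makes \<open>F\<close> integrable with respect to
  \<open>\<gamma>\<close> by comparison with a geometric series, hence finite \<open>\<gamma>\<close>-almost everywhere.

  Both parts then follow from one criterion (\<open>non_explosive_if_total_progeny_finite\<close>): there is no
  explosion from \<open>x\<close> as soon as \<open>F\<close> is finite \<open>p x\<close>-almost everywhere. For \<open>\<gamma>\<close>-almost every \<open>x\<close>
  this holds by invariance of \<open>\<gamma>\<close>, and for \<open>x\<^sub>0\<close> by absolute continuity of \<open>p x\<^sub>0\<close>. Under \<open>p x\<close> the
  function \<open>F\<close> need not be integrable, only finite; the proof of the criterion therefore weights the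
  sum by \<open>1 / (1 + F)\<close> at the two children of the root, whose states have law \<open>p x\<close>. The states
  \<open>X\<^sub>v\<close> may depend on the clocks, only the intensities \<open>\<lambda>(X\<^sub>v)\<close> are independent of them. For this
  reason the weights are applied to the products of \<open>\<lambda> / (a + \<lambda>)\<close>, after the clocks have been
  integrated out, and never to \<open>exp (- a S\<^sub>v)\<close>.
\<close>

section \<open>Explosion and exponential discounting\<close>

lemma finite_level: "finite {v :: vertex. length v = n}"
  using finite_lists_length_eq[of "UNIV :: bool set" n] by simp

text \<open>
  A level whose discounted sum is below \<open>exp (- a c)\<close> has all its path sums above \<open>c\<close>.
\<close>

lemma explosion_time_eq_infinity:
  fixes l t :: "vertex \<Rightarrow> real"
  assumes a: "0 < a"
    and fin: "(\<Sum>n. \<Sum>v | length v = Suc n.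
               ennreal (exp (- a * (\<Sum>j=0..length v. t (take j v) / l (take j v))))) \<noteq> \<infinity>"
  shows "explosion_time (\<lambda>v _. l v) (\<lambda>v _. t v) \<omega> = \<infinity>"
proof -
  define s where "s v = (\<Sum>j=0..length v. t (take j v) / l (take j v))" for v
  have level_ne: "{v :: vertex. length v = n} \<noteq> {}" for n
    using length_replicate[of n True] by blast
  have "(\<Sum>n. ennreal (\<Sum>v | length v = Suc n. exp (- a * s v))) \<noteq> top"
    using fin by (simp add: s_def sum_ennreal)
  then have "summable (\<lambda>n. \<Sum>v | length v = Suc n. exp (- a * s v))"
    by (rule summable_suminf_not_top[rotated]) (simp add: sum_nonneg)
  then have lim: "(\<lambda>n. \<Sum>v | length v = Suc n. exp (- a * s v)) \<longlonglongrightarrow> 0"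
    by (rule summable_LIMSEQ_zero)
  have "ereal c \<le> explosion_time (\<lambda>v _. l v) (\<lambda>v _. t v) \<omega>" for c
  proof -
    have "\<forall>\<^sub>F n in sequentially. (\<Sum>v | length v = Suc n. exp (- a * s v)) < exp (- a * c)"
      by (rule order_tendstoD[OF lim]) simp
    then obtain n where n: "(\<Sum>v | length v = Suc n. exp (- a * s v)) < exp (- a * c)"
      by (auto simp: eventually_sequentially)
    have "c \<le> s v" if v: "length v = Suc n" for v
    proof -
      have "exp (- a * s v) \<le> (\<Sum>v | length v = Suc n. exp (- a * s v))"
        using finite_level v by (intro member_le_sum) auto
      with n have "exp (- a * s v) < exp (- a * c)" by linarith
      then show ?thesis using a by simp
    qed
    then have "c \<le> (MIN v\<in>{v. length v = Suc n}. \<Sum>j=0..Suc n. t (take j v) / l (take j v))"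
      using finite_level level_ne by (subst Min_ge_iff) (auto simp: s_def)
    then show ?thesis
      unfolding explosion_time_def by (intro SUP_upper2[of "Suc n"]) auto
  qed
  then show ?thesis by (metis ereal_top)
qed

text \<open>
  Tilting the exponential density of rate \<open>1\<close> by \<open>exp (- b x)\<close> gives the density of rate \<open>1 + b\<close>
  up to the factor \<open>1 / (1 + b)\<close>.
\<close>

lemma nn_integral_exp_exponential:
  assumes M: "prob_space M" and D: "distributed M lborel T (exponential_density 1)" and b: "0 \<le> b"
  shows "(\<integral>\<^sup>+\<omega>. ennreal (exp (- b * T \<omega>)) \<partial>M) = ennreal (1 / (1 + b))"
proof -
  interpret E: prob_space "density lborel (exponential_density (1 + b))"
    using b by (intro prob_space_exponential_density) auto
  have "(\<integral>\<^sup>+\<omega>. ennreal (exp (- b * T \<omega>)) \<partial>M)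
      = (\<integral>\<^sup>+x. ennreal (exponential_density 1 x) * ennreal (exp (- b * x)) \<partial>lborel)"
    by (rule distributed_nn_integral[OF D, symmetric]) auto
  also have "\<dots> = (\<integral>\<^sup>+x. ennreal (1 / (1 + b)) * ennreal (exponential_density (1 + b) x) \<partial>lborel)"
    using b by (intro nn_integral_cong)
      (auto simp: exponential_density_def ennreal_mult[symmetric] exp_add[symmetric] algebra_simps divide_simps)
  also have "\<dots> = ennreal (1 / (1 + b)) * (\<integral>\<^sup>+x. ennreal (exponential_density (1 + b) x) \<partial>lborel)"
    by (rule nn_integral_cmult) auto
  also have "(\<integral>\<^sup>+x. ennreal (exponential_density (1 + b) x) \<partial>lborel) = 1"
    using E.emeasure_space_1 by (simp add: emeasure_density)
  finally show ?thesis by simp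
qed

text \<open>
  The probability that the clocks \<open>T / l\<close> along the path to \<open>v\<close>, root and \<open>v\<close> included, all ring before
  independent killing clocks of rate \<open>a\<close>.
\<close>

definition survival_weight :: "real \<Rightarrow> (vertex \<Rightarrow> real) \<Rightarrow> vertex \<Rightarrow> real" where
  "survival_weight a l v = (\<Prod>j=0..length v. l (take j v) / (a + l (take j v)))"

text \<open>
  The vertices on a path are distinct, so their clocks are independent and the Laplace transform
  of the path sum factorises.
\<close>

lemma nn_integral_discount_path:
  assumes M: "prob_space M" and a: "0 < a"
    and indep: "prob_space.indep_vars M (\<lambda>_. borel) T UNIV"
    and D: "\<And>v. distributed M lborel (T v) (exponential_density 1)"
    and l: "\<And>v. 0 < l v"
  shows "(\<integral>\<^sup>+\<omega>. ennreal (exp (- a * (\<Sum>j=0..length v. T (take j v) \<omega> / l (take j v)))) \<partial>M)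
      = ennreal (survival_weight a l v)"
proof -
  interpret prob_space M by fact
  let ?A = "(\<lambda>j. take j v) ` {0..length v}"
  have inj: "inj_on (\<lambda>j. take j v) {0..length v}"
    by (rule inj_on_inverseI[of _ length]) auto
  have indep': "indep_vars (\<lambda>_. borel) (\<lambda>u \<omega>. ennreal (exp (- (a / l u) * T u \<omega>))) ?A"
    by (rule indep_vars_compose2[OF indep_vars_subset[OF indep]]) auto
  have "(\<integral>\<^sup>+\<omega>. ennreal (exp (- a * (\<Sum>j=0..length v. T (take j v) \<omega> / l (take j v)))) \<partial>M)
      = (\<integral>\<^sup>+\<omega>. (\<Prod>u\<in>?A. ennreal (exp (- (a / l u) * T u \<omega>))) \<partial>M)"
    by (simp add: prod.reindex[OF inj] prod_ennreal exp_sum[symmetric] sum_distrib_left sum_negf)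
  also have "\<dots> = (\<Prod>u\<in>?A. \<integral>\<^sup>+\<omega>. ennreal (exp (- (a / l u) * T u \<omega>)) \<partial>M)"
    by (rule indep_vars_nn_integral[OF _ indep']) auto
  also have "\<dots> = (\<Prod>u\<in>?A. ennreal (l u / (a + l u)))"
  proof (rule prod.cong[OF refl])
    fix u
    have "1 / (1 + a / l u) = l u / (a + l u)" using l[of u] by (simp add: field_simps)
    then show "(\<integral>\<^sup>+\<omega>. ennreal (exp (- (a / l u) * T u \<omega>)) \<partial>M) = ennreal (l u / (a + l u))"
      using nn_integral_exp_exponential[OF M D, of "a / l u" u] a l[of u] by (simp add: less_imp_le)
  qed
  also have "\<dots> = ennreal (survival_weight a l v)"
    unfolding prod.reindex[OF inj] comp_def survival_weight_def
    using a l by (intro prod_ennreal) (auto simp: less_imp_le add_pos_pos)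
  finally show ?thesis .
qed

text \<open>
  Independence makes the joint law of intensities and clocks a product measure, so the clocks can be
  integrated out for fixed intensities \<open>l\<close>. Where the survival weights of \<open>l\<close> are summable, the
  discounted sum has finite mean over the clocks and is almost surely finite.
\<close>

lemma non_explosive_if_summable_survival_weights:
  assumes dsy: "dsy_cascade M L T" and a: "0 < a"
    and fin: "AE \<omega> in M. (\<Sum>n. \<Sum>v | length v = Suc n. ennreal (survival_weight a (\<lambda>u. L u \<omega>) v)) \<noteq> \<infinity>"
  shows "non_explosive M L T"
proof -
  from dsy have M: "prob_space M" and Ti: "prob_space.indep_vars M (\<lambda>_. borel) T UNIV"
    and D: "\<And>v. distributed M lborel (T v) (exponential_density 1)"
    and Lm[measurable]: "\<And>v. L v \<in> borel_measurable M"
    and Lpos: "\<And>v \<omega>. \<omega> \<in> space M \<Longrightarrow> 0 < L v \<omega>"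
    and LT: "prob_space.indep_var M (PiM UNIV (\<lambda>_. borel)) (\<lambda>\<omega> v. L v \<omega>)
       (PiM UNIV (\<lambda>_. borel)) (\<lambda>\<omega> v. T v \<omega>)"
    unfolding dsy_cascade_def by auto
  interpret prob_space M by fact
  have Tm[measurable]: "T v \<in> borel_measurable M" for v
    using D[of v] by (auto simp: distributed_def)
  let ?P = "PiM UNIV (\<lambda>_. borel) :: (vertex \<Rightarrow> real) measure"
  let ?L = "\<lambda>\<omega> v. L v \<omega>" and ?T = "\<lambda>\<omega> v. T v \<omega>"
  have Lm'[measurable]: "?L \<in> M \<rightarrow>\<^sub>M ?P" by (rule measurable_PiM_single') auto
  have Tm'[measurable]: "?T \<in> M \<rightarrow>\<^sub>M ?P" by (rule measurable_PiM_single') auto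
  define E where "E l t n = (\<Sum>v | length v = Suc n.
      ennreal (exp (- a * (\<Sum>j=0..length v. t (take j v) / l (take j v)))))"
    for l t :: "vertex \<Rightarrow> real" and n :: nat
  have Em[measurable]: "(\<lambda>z. E (fst z) (snd z) n) \<in> borel_measurable (?P \<Otimes>\<^sub>M ?P)" for n
    unfolding E_def by measurable
  have joint: "distr M ?P ?L \<Otimes>\<^sub>M distr M ?P ?T = distr M (?P \<Otimes>\<^sub>M ?P) (\<lambda>\<omega>. (?L \<omega>, ?T \<omega>))"
    using LT by (simp add: indep_var_distribution_eq)
  have level_set: "{z \<in> space (?P \<Otimes>\<^sub>M ?P). (\<Sum>n. E (fst z) (snd z) n) \<noteq> \<infinity>} \<in> sets (?P \<Otimes>\<^sub>M ?P)"
    by measurable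
  interpret PL: prob_space "distr M ?P ?L" by (rule prob_space_distr) measurable
  interpret PT: prob_space "distr M ?P ?T" by (rule prob_space_distr) measurable
  interpret LT: pair_sigma_finite "distr M ?P ?L" "distr M ?P ?T" ..
  have quenched: "AE t in distr M ?P ?T. (\<Sum>n. E l t n) \<noteq> \<infinity>"
    if l: "\<forall>v. 0 < l v"
      and s: "(\<Sum>n. \<Sum>v | length v = Suc n. ennreal (survival_weight a l v)) \<noteq> \<infinity>" for l
  proof -
    have El[measurable]: "(\<lambda>t. E l t n) \<in> borel_measurable ?P" for n
      unfolding E_def by measurable
    have path: "(\<integral>\<^sup>+\<omega>. ennreal (exp (- a * (\<Sum>j=0..length v. T (take j v) \<omega> / l (take j v)))) \<partial>M)
        = ennreal (survival_weight a l v)" for v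
      using l by (intro nn_integral_discount_path[OF M a Ti D]) auto
    have "(\<integral>\<^sup>+t. (\<Sum>n. E l t n) \<partial>distr M ?P ?T) = (\<integral>\<^sup>+\<omega>. (\<Sum>n. E l (?T \<omega>) n) \<partial>M)"
      by (rule nn_integral_distr) measurable
    also have "\<dots> = (\<Sum>n. \<integral>\<^sup>+\<omega>. E l (?T \<omega>) n \<partial>M)"
      by (rule nn_integral_suminf) measurable
    also have "\<dots> = (\<Sum>n. \<Sum>v | length v = Suc n. ennreal (survival_weight a l v))"
      unfolding E_def
      by (subst nn_integral_sum) (simp_all only: path, measurable)
    finally show ?thesis
      using s by (intro nn_integral_noteq_infinite) auto
  qed
  have "AE l in distr M ?P ?L. (\<forall>v. 0 < l v) \<and>
      (\<Sum>n. \<Sum>v | length v = Suc n. ennreal (survival_weight a l v)) \<noteq> \<infinity>"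
    using fin Lpos unfolding survival_weight_def by (subst AE_distr_iff) auto
  then have "AE l in distr M ?P ?L. AE t in distr M ?P ?T. (\<Sum>n. E l t n) \<noteq> \<infinity>"
    by (rule AE_mp) (rule AE_I2, use quenched in blast)
  then have "AE z in distr M ?P ?L \<Otimes>\<^sub>M distr M ?P ?T. (\<Sum>n. E (fst z) (snd z) n) \<noteq> \<infinity>"
    using level_set by (intro LT.AE_pair_measure) (simp_all add: joint)
  then have "AE \<omega> in M. (\<Sum>n. E (?L \<omega>) (?T \<omega>) n) \<noteq> \<infinity>"
    unfolding joint by (subst (asm) AE_distr_iff) auto
  then have "AE \<omega> in M. explosion_time L T \<omega> = \<infinity>"
  proof eventually_elim
    case (elim \<omega>)
    then have "explosion_time (\<lambda>v _. L v \<omega>) (\<lambda>v _. T v \<omega>) \<omega> = \<infinity>"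
      unfolding E_def by (intro explosion_time_eq_infinity[OF a])
    then show ?case by (simp add: explosion_time_def)
  qed
  moreover have "explosion_time L T \<in> borel_measurable M"
    unfolding explosion_time_def using finite_level by measurable
  ultimately show ?thesis
    unfolding non_explosive_def by (subst prob_Collect_eq_1) auto
qed

section \<open>The Markov property for nonnegative functions\<close>

lemma space_history: "space (history M S Y n) = space M"
  by (simp add: history_def space_measure_of_conv)

lemma sets_history:
  "sets (history M S Y n) = sigma_sets (space M) (\<Union>i\<le>n. {Y i -` A \<inter> space M | A. A \<in> sets S})"
  unfolding history_def by (rule sets_measure_of) auto

lemma measurable_history:
  assumes "Y k \<in> M \<rightarrow>\<^sub>M S" "k \<le> n"
  shows "Y k \<in> history M S Y n \<rightarrow>\<^sub>M S"
proof (rule measurableI)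
  show "Y k x \<in> space S" if "x \<in> space (history M S Y n)" for x
    using that measurable_space[OF assms(1)] by (simp add: space_history)
next
  fix A assume A: "A \<in> sets S"
  then have "Y k -` A \<inter> space M \<in> (\<Union>i\<le>n. {Y i -` A \<inter> space M | A. A \<in> sets S})"
    using assms(2) by blast
  then show "Y k -` A \<inter> space (history M S Y n) \<in> sets (history M S Y n)"
    unfolding sets_history space_history by (rule sigma_sets.Basic)
qed

lemma subalgebra_history:
  assumes "\<And>k. Y k \<in> M \<rightarrow>\<^sub>M S"
  shows "subalgebra M (history M S Y n)"
proof -
  have "(\<Union>i\<le>n. {Y i -` A \<inter> space M | A. A \<in> sets S}) \<subseteq> sets M"
    using assms by (blast intro: measurable_sets)
  then have "sets (history M S Y n) \<subseteq> sets M"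
    unfolding sets_history by (rule sets.sigma_sets_subset)
  then show ?thesis
    by (simp add: subalgebra_def space_history)
qed

text \<open>
  In the induction for \<open>expectation_path_product\<close> a weight known at time \<open>m\<close> is reused at time \<open>m + 1\<close>.
\<close>

lemma measurable_history_mono:
  assumes "m \<le> n" "f \<in> borel_measurable (history M S Y m)"
  shows "f \<in> borel_measurable (history M S Y n)"
proof (rule measurable_from_subalg[OF _ assms(2)])
  have "sets (history M S Y m) \<subseteq> sets (history M S Y n)"
    unfolding sets_history by (rule sigma_sets_mono') (use assms(1) in \<open>blast intro: order_trans\<close>)
  then show "subalgebra (history M S Y n) (history M S Y m)"
    by (simp add: subalgebra_def space_history)
qed

text \<open>
  The Markov property for events extends to nonnegative functions \<open>u\<close> because it says that the law of
  \<open>Y (Suc n)\<close> under the measure with density \<open>G\<close> is the law of \<open>Y n\<close> under that measure followed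
  by a step of \<open>p\<close>.
\<close>

lemma markov_chain_step:
  fixes u :: "'a \<Rightarrow> ennreal"
  assumes M: "prob_space M" and Y: "markov_chain M S p Y" and p: "p \<in> S \<rightarrow>\<^sub>M prob_algebra S"
    and G: "G \<in> borel_measurable (history M S Y n)" and u: "u \<in> borel_measurable S"
  shows "(\<integral>\<^sup>+\<omega>. G \<omega> * u (Y (Suc n) \<omega>) \<partial>M) = (\<integral>\<^sup>+\<omega>. G \<omega> * (\<integral>\<^sup>+y. u y \<partial>p (Y n \<omega>)) \<partial>M)"
proof -
  interpret prob_space M by fact
  let ?H = "history M S Y n"
  have Ym[measurable]: "Y k \<in> M \<rightarrow>\<^sub>M S" for k using Y by (simp add: markov_chain_def)
  have sub: "subalgebra M ?H" by (rule subalgebra_history) (rule Ym)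
  interpret finite_measure_subalgebra M ?H by unfold_locales (rule sub)
  have YH[measurable]: "Y n \<in> ?H \<rightarrow>\<^sub>M S" by (rule measurable_history) (auto intro: Ym)
  have p'[measurable]: "p \<in> S \<rightarrow>\<^sub>M subprob_algebra S" by (rule measurable_prob_algebraD) fact
  have GM[measurable]: "G \<in> borel_measurable M" by (rule measurable_from_subalg[OF sub G])
  have p_prob: "prob_space (p x)" "sets (p x) = sets S" if "x \<in> space S" for x
    using measurable_space[OF p that] by (auto simp: space_prob_algebra)
  have event: "(\<integral>\<^sup>+\<omega>. G \<omega> * indicator A (Y (Suc n) \<omega>) \<partial>M) = (\<integral>\<^sup>+\<omega>. G \<omega> * emeasure (p (Y n \<omega>)) A \<partial>M)"
    if A[measurable]: "A \<in> sets S" for A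
  proof -
    let ?I = "indicator (Y (Suc n) -` A \<inter> space M) :: _ \<Rightarrow> real"
    have Ae[measurable]: "Y (Suc n) -` A \<inter> space M \<in> sets M" by measurable
    have em: "emeasure (p (Y n \<omega>)) A = ennreal (measure (p (Y n \<omega>)) A)" if "\<omega> \<in> space M" for \<omega>
      using p_prob(1)[OF measurable_space[OF Ym that]]
      by (intro finite_measure.emeasure_eq_measure prob_space.finite_measure)
    have le1: "measure (p (Y n \<omega>)) A \<le> 1" if "\<omega> \<in> space M" for \<omega>
      using p_prob(1)[OF measurable_space[OF Ym that]] by (rule prob_space.prob_le_1)
    have ce: "AE \<omega> in M. real_cond_exp M ?H ?I \<omega> = measure (p (Y n \<omega>)) A"
      using Y A by (auto simp: markov_chain_def)
    have "AE \<omega> in M. emeasure (p (Y n \<omega>)) A = nn_cond_exp M ?H (\<lambda>\<omega>. ennreal (?I \<omega>)) \<omega>"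
    proof (rule nn_cond_exp_charact)
      fix B assume B: "B \<in> sets ?H"
      then have BM[measurable]: "B \<in> sets M" using sub by (auto simp: subalgebra_def)
      have int: "integrable M (\<lambda>\<omega>. indicator B \<omega> * ?I \<omega>)"
        by (rule integrable_const_bound[of _ 1]) (auto simp: indicator_def)
      have "(\<integral>\<omega>. indicator B \<omega> * ?I \<omega> \<partial>M) = (\<integral>\<omega>. indicator B \<omega> * real_cond_exp M ?H ?I \<omega> \<partial>M)"
        using B by (intro real_cond_exp_intg(2)[OF int, symmetric]) auto
      also have "\<dots> = (\<integral>\<omega>. indicator B \<omega> * measure (p (Y n \<omega>)) A \<partial>M)"
        using ce by (intro integral_cong_AE) auto
      finally have eq: "(\<integral>\<omega>. indicator B \<omega> * ?I \<omega> \<partial>M) = (\<integral>\<omega>. indicator B \<omega> * measure (p (Y n \<omega>)) A \<partial>M)" .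
      have "(\<integral>\<^sup>+\<omega>\<in>B. ennreal (?I \<omega>) \<partial>M) = ennreal (\<integral>\<omega>. indicator B \<omega> * ?I \<omega> \<partial>M)"
        by (subst nn_integral_eq_integral[symmetric])
          (auto intro!: integrable_const_bound[of _ 1] nn_integral_cong simp: indicator_def)
      also have "\<dots> = (\<integral>\<^sup>+\<omega>. ennreal (indicator B \<omega> * measure (p (Y n \<omega>)) A) \<partial>M)"
        unfolding eq
        by (rule nn_integral_eq_integral[symmetric])
          (auto intro!: integrable_const_bound[of _ 1] AE_I2 simp: indicator_def le1)
      also have "\<dots> = (\<integral>\<^sup>+\<omega>\<in>B. emeasure (p (Y n \<omega>)) A \<partial>M)"
        by (intro nn_integral_cong) (auto simp: em indicator_def)
      finally show "(\<integral>\<^sup>+\<omega>\<in>B. ennreal (?I \<omega>) \<partial>M) = (\<integral>\<^sup>+\<omega>\<in>B. emeasure (p (Y n \<omega>)) A \<partial>M)" .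
    qed measurable
    then have "(\<integral>\<^sup>+\<omega>. G \<omega> * emeasure (p (Y n \<omega>)) A \<partial>M)
        = (\<integral>\<^sup>+\<omega>. G \<omega> * nn_cond_exp M ?H (\<lambda>\<omega>. ennreal (?I \<omega>)) \<omega> \<partial>M)"
      by (intro nn_integral_cong_AE) auto
    also have "\<dots> = (\<integral>\<^sup>+\<omega>. G \<omega> * ennreal (?I \<omega>) \<partial>M)"
      by (rule nn_cond_exp_intg[OF G]) measurable
    also have "\<dots> = (\<integral>\<^sup>+\<omega>. G \<omega> * indicator A (Y (Suc n) \<omega>) \<partial>M)"
      by (intro nn_integral_cong) (auto simp: indicator_def)
    finally show ?thesis by simp
  qed
  have ne: "space M \<noteq> {}" by (rule not_empty)
  let ?N = "distr (density M G) S (Y n)"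
  have "distr (density M G) S (Y (Suc n)) = ?N \<bind> p"
  proof (rule measure_eqI)
    have sN: "sets (?N \<bind> p) = sets S"
      using ne measurable_space[OF Ym, of _ n]
      by (intro sets_bind) (auto simp: p_prob)
    then show "sets (distr (density M G) S (Y (Suc n))) = sets (?N \<bind> p)" by simp
    fix A assume "A \<in> sets (distr (density M G) S (Y (Suc n)))"
    then have A[measurable]: "A \<in> sets S" by simp
    have "emeasure (?N \<bind> p) A = (\<integral>\<^sup>+\<omega>. G \<omega> * emeasure (p (Y n \<omega>)) A \<partial>M)"
      using ne measurable_space[OF Ym, of _ n]
      by (subst emeasure_bind[where N=S]) (auto simp: nn_integral_distr nn_integral_density)
    also have "\<dots> = (\<integral>\<^sup>+\<omega>. G \<omega> * indicator A (Y (Suc n) \<omega>) \<partial>M)" by (rule event[OF A, symmetric])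
    also have "\<dots> = emeasure (distr (density M G) S (Y (Suc n))) A"
      by (auto simp: emeasure_distr emeasure_density indicator_def intro!: nn_integral_cong)
    finally show "emeasure (distr (density M G) S (Y (Suc n))) A = emeasure (?N \<bind> p) A" by simp
  qed
  then have "(\<integral>\<^sup>+y. u y \<partial>distr (density M G) S (Y (Suc n))) = (\<integral>\<^sup>+y. u y \<partial>(?N \<bind> p))" by simp
  moreover have pN: "p \<in> ?N \<rightarrow>\<^sub>M subprob_algebra S" using p' by simp
  moreover have "(\<lambda>x. \<integral>\<^sup>+y. u y \<partial>p x) \<in> borel_measurable S" using u by measurable
  ultimately show ?thesis
    using u by (simp add: nn_integral_bind[OF u pN] nn_integral_distr nn_integral_density)
qed

section \<open>The killed chain and the mean number of survivors\<close>

text \<open>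
  The two bounds that make \<open>1 / (1 + t)\<close> a usable weight: it is bounded, and it tames \<open>t\<close> itself.
\<close>

lemma inverse_one_plus_ennreal:
  fixes t :: ennreal
  shows "inverse (1 + t) \<le> 1" "inverse (1 + t) * t \<le> 1"
proof -
  have "inverse (1 + t) \<le> 1 \<and> inverse (1 + t) * t \<le> 1"
  proof (cases t)
    case (real r)
    then have "inverse (1 + t) = ennreal (inverse (1 + r))"
      by (subst inverse_ennreal[symmetric]) auto
    moreover from real have "inverse (1 + r) \<le> 1" "inverse (1 + r) * r \<le> 1"
      by (auto simp: field_simps)
    ultimately show ?thesis
      using real by (simp add: ennreal_mult''[symmetric])
  qed simp
  then show "inverse (1 + t) \<le> 1" "inverse (1 + t) * t \<le> 1" by auto
qed

lemma summable_progeny_if_root_less_half: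
  fixes c :: "nat \<Rightarrow> real"
  assumes c: "\<And>n. 0 \<le> c n" and lim: "limsup (\<lambda>n. ereal (root n (c n))) < ereal (1/2)"
  shows "summable (\<lambda>n. 2 ^ n * c n)"
proof -
  obtain r where r: "limsup (\<lambda>n. ereal (root n (c n))) < ereal r" "ereal r < ereal (1/2)"
    using ereal_dense2[OF lim] by blast
  have "\<forall>\<^sub>F n in sequentially. norm (2 ^ n * c n) \<le> (2 * max r 0) ^ n"
    using Limsup_lessD[OF r(1)] eventually_gt_at_top[of 0]
  proof eventually_elim
    case (elim n)
    have "c n = root n (c n) ^ n" using elim c by simp
    also have "\<dots> \<le> max r 0 ^ n" using elim c by (intro power_mono) auto
    finally show ?case using c[of n] by (simp add: power_mult_distrib)
  qed
  moreover have "summable (\<lambda>n. (2 * max r 0) ^ n)" using r(2) by (intro summable_geometric) auto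
  ultimately show ?thesis by (rule summable_comparison_test_ev)
qed

text \<open>
  The chain with kernel \<open>p\<close> that is killed in state \<open>x\<close> with probability \<open>a / (a + lam x)\<close>.
\<close>

locale killed_kernel =
  fixes S :: "'a measure" and p :: "'a \<Rightarrow> 'a measure" and lam :: "'a \<Rightarrow> real" and a :: real
  assumes kernel: "p \<in> S \<rightarrow>\<^sub>M prob_algebra S"
    and lam_measurable[measurable]: "lam \<in> borel_measurable S"
    and lam_pos: "\<And>x. x \<in> space S \<Longrightarrow> 0 < lam x"
    and a_pos: "0 < a"
begin

text \<open>
  The function \<open>(T\<^sub>a)\<^sup>n 1\<close>: the probability that the killed chain started in the argument survives
  its first \<open>n\<close> states.
\<close>

definition survival :: "nat \<Rightarrow> 'a \<Rightarrow> real" where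
  "survival n = (T_op p lam a ^^ n) (\<lambda>_. 1)"

text \<open>
  The function is meant for the state \<open>x\<close> of a child of the root. The path from such a child to a
  vertex of height \<open>n + 1\<close> visits \<open>n + 1\<close> states, and the tree has \<open>2 ^ Suc n\<close> vertices of that
  height. Both subtrees are counted, so the value is twice the mean number of surviving paths that
  start at one child. It may be infinite.
\<close>

definition total_progeny :: "'a \<Rightarrow> ennreal" where
  "total_progeny x = (\<Sum>n. ennreal (2 ^ Suc n * survival (Suc n) x))"

lemma kernel_subprob[measurable]: "p \<in> S \<rightarrow>\<^sub>M subprob_algebra S"
  by (rule measurable_prob_algebraD) (rule kernel)

lemma kernel_prob: "x \<in> space S \<Longrightarrow> prob_space (p x)"
  and sets_kernel: "x \<in> space S \<Longrightarrow> sets (p x) = sets S"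
  using measurable_space[OF kernel] by (auto simp: space_prob_algebra)

lemma space_kernel: "x \<in> space S \<Longrightarrow> space (p x) = space S"
  by (rule sets_eq_imp_space_eq) (rule sets_kernel)

lemma survival_0[simp]: "survival 0 x = 1"
  by (simp add: survival_def)

lemma survival_rec: "survival (Suc n) x = lam x / (a + lam x) * (\<integral>y. survival n y \<partial>p x)"
  by (simp add: survival_def T_op_def)

lemma survival_measurable[measurable]: "survival n \<in> borel_measurable S"
proof (induction n)
  case (Suc n)
  then have [measurable]: "(\<lambda>x. \<integral>y. survival n y \<partial>p x) \<in> borel_measurable S"
    by (intro measurable_compose[OF kernel_subprob integral_measurable_subprob_algebra])
  show ?case by (subst measurable_cong[OF survival_rec]) measurable
qed (simp add: survival_def)

lemma total_progeny_measurable[measurable]: "total_progeny \<in> borel_measurable S"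
  unfolding total_progeny_def[abs_def] by measurable

lemma integrable_bounded_kernel:
  assumes "x \<in> space S" "f \<in> borel_measurable S" "\<And>y. y \<in> space S \<Longrightarrow> 0 \<le> f y \<and> f y \<le> (1::real)"
  shows "integrable (p x) f"
proof -
  interpret prob_space "p x" by (rule kernel_prob) fact
  show ?thesis
    using assms
    by (intro integrable_const_bound[of _ 1] AE_I2)
      (auto simp: space_kernel measurable_cong_sets[OF sets_kernel refl])
qed

lemma survival_bounds:
  assumes "x \<in> space S"
  shows "0 \<le> survival n x \<and> survival n x \<le> 1"
  using assms
proof (induction n arbitrary: x)
  case (Suc n)
  interpret prob_space "p x" by (rule kernel_prob) fact
  have "0 \<le> (\<integral>y. survival n y \<partial>p x)"
    using Suc by (intro integral_nonneg_AE AE_I2) (auto simp: space_kernel)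
  moreover have "(\<integral>y. survival n y \<partial>p x) \<le> 1"
    using Suc by (intro integral_le_const AE_I2 integrable_bounded_kernel) (auto simp: space_kernel)
  moreover have "0 \<le> lam x / (a + lam x)" "lam x / (a + lam x) \<le> 1"
    using lam_pos[OF Suc.prems] a_pos by auto
  ultimately show ?case
    unfolding survival_rec by (intro conjI mult_nonneg_nonneg mult_le_one)
qed simp

lemma survival_Suc:
  assumes "x \<in> space S"
  shows "ennreal (survival (Suc n) x)
    = ennreal (lam x / (a + lam x)) * (\<integral>\<^sup>+y. ennreal (survival n y) \<partial>p x)"
proof -
  have "(\<integral>\<^sup>+y. ennreal (survival n y) \<partial>p x) = ennreal (\<integral>y. survival n y \<partial>p x)"
    using assms survival_bounds
    by (intro nn_integral_eq_integral integrable_bounded_kernel AE_I2) (auto simp: space_kernel)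
  moreover have "0 \<le> (\<integral>y. survival n y \<partial>p x)"
    using assms survival_bounds by (intro integral_nonneg_AE AE_I2) (auto simp: space_kernel)
  moreover have "0 \<le> lam x / (a + lam x)"
    using lam_pos[OF assms] a_pos by auto
  ultimately show ?thesis unfolding survival_rec by (simp only: ennreal_mult)
qed

text \<open>
  The factor at time \<open>m\<close> is known at time \<open>m\<close>, so it can be absorbed into the weight \<open>G\<close>; the
  remaining product starts at time \<open>m + 1\<close>, and one step of the chain followed by that factor is the
  operator of the recursion for \<open>survival\<close>. Hence \<open>m\<close> and \<open>G\<close> vary in the induction.
\<close>

lemma expectation_path_product:
  assumes M: "prob_space M" and Y: "markov_chain M S p Y"
    and G: "G \<in> borel_measurable (history M S Y m)"
  shows "(\<integral>\<^sup>+\<omega>. G \<omega> * (\<Prod>j<n. ennreal (lam (Y (m + j) \<omega>) / (a + lam (Y (m + j) \<omega>)))) \<partial>M)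
    = (\<integral>\<^sup>+\<omega>. G \<omega> * ennreal (survival n (Y m \<omega>)) \<partial>M)"
  using G
proof (induction n arbitrary: m G)
  case (Suc n)
  have Ym: "Y k \<in> M \<rightarrow>\<^sub>M S" for k using Y by (simp add: markov_chain_def)
  have [measurable]: "Y m \<in> history M S Y m \<rightarrow>\<^sub>M S" by (rule measurable_history) (auto intro: Ym)
  note Suc.prems[measurable]
  let ?h = "\<lambda>k \<omega>. ennreal (lam (Y k \<omega>) / (a + lam (Y k \<omega>)))"
  have Gh: "(\<lambda>\<omega>. G \<omega> * ?h m \<omega>) \<in> borel_measurable (history M S Y m)" by measurable
  have "(\<integral>\<^sup>+\<omega>. G \<omega> * (\<Prod>j<Suc n. ?h (m + j) \<omega>) \<partial>M)
      = (\<integral>\<^sup>+\<omega>. (G \<omega> * ?h m \<omega>) * (\<Prod>j<n. ?h (Suc m + j) \<omega>) \<partial>M)"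
    by (simp only: prod.lessThan_Suc_shift) (simp add: mult.assoc)
  also have "\<dots> = (\<integral>\<^sup>+\<omega>. (G \<omega> * ?h m \<omega>) * ennreal (survival n (Y (Suc m) \<omega>)) \<partial>M)"
    by (rule Suc.IH, rule measurable_history_mono[OF _ Gh]) simp
  also have "\<dots> = (\<integral>\<^sup>+\<omega>. (G \<omega> * ?h m \<omega>) * (\<integral>\<^sup>+y. ennreal (survival n y) \<partial>p (Y m \<omega>)) \<partial>M)"
    by (rule markov_chain_step[OF M Y kernel Gh]) measurable
  also have "\<dots> = (\<integral>\<^sup>+\<omega>. G \<omega> * ennreal (survival (Suc n) (Y m \<omega>)) \<partial>M)"
    using measurable_space[OF Ym]
    by (intro nn_integral_cong) (simp add: survival_Suc mult.assoc)
  finally show ?case .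
qed simp

text \<open>
  The states of the two children of the root have law \<open>p x\<close>, so both weights \<open>1 / (1 + F)\<close> are almost
  surely positive. On the path to a vertex \<open>v\<close> only the weight of the child through which the path
  passes belongs to the history of the chain; the other one is at most \<open>1\<close> and is dropped. The
  Markov property then bounds the mean of the weighted sum by the integral of \<open>F / (1 + F)\<close> under
  \<open>p x\<close>, which is at most \<open>1\<close>. Hence the weighted sum, and with it the unweighted one, is almost
  surely finite. Here \<open>F\<close> stands for \<open>total_progeny\<close>.
\<close>

lemma non_explosive_if_total_progeny_finite:
  assumes casc: "dsy_cascade_type_M M S p lam X T"
    and x: "x \<in> space S" and root: "AE \<omega> in M. X [] \<omega> = x"
    and fin: "AE y in p x. total_progeny y \<noteq> \<infinity>"
  shows "non_explosive M (\<lambda>v \<omega>. lam (X v \<omega>)) T"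
proof -
  have dsy: "dsy_cascade M (\<lambda>v \<omega>. lam (X v \<omega>)) T"
    and chain: "\<And>s. markov_chain M S p (\<lambda>n. X (path_vertex s n))"
    using casc by (auto simp: dsy_cascade_type_M_def)
  then have M: "prob_space M" by (simp add: dsy_cascade_def)
  interpret prob_space M by fact
  interpret P: prob_space "p x" by (rule kernel_prob[OF x])
  \<comment> \<open>The Markov property is given along infinite paths; beyond \<open>v\<close> any continuation serves.\<close>
  define ray where "ray v = (\<lambda>i. if i < length v then v ! i else False)" for v :: vertex
  have ray: "path_vertex (ray v) j = take j v" if "j \<le> length v" for v j
    using that by (intro nth_equalityI) (auto simp: path_vertex_def ray_def)
  have Xm[measurable]: "X v \<in> M \<rightarrow>\<^sub>M S" for v
    using chain[of "ray v"] ray[of "length v" v] by (auto simp: markov_chain_def dest: spec[of _ "length v"])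
  have Xs: "X v \<omega> \<in> space S" if "\<omega> \<in> space M" for v \<omega>
    using measurable_space[OF Xm that] .
  have h01: "0 \<le> lam y / (a + lam y)" "lam y / (a + lam y) \<le> 1" if "y \<in> space S" for y
    using lam_pos[OF that] a_pos by auto
  have child: "(\<integral>\<^sup>+\<omega>. u (X [b] \<omega>) \<partial>M) = (\<integral>\<^sup>+y. u y \<partial>p x)"
    if u: "u \<in> borel_measurable S" for u :: "'a \<Rightarrow> ennreal" and b
  proof -
    have "(\<integral>\<^sup>+\<omega>. u (X [b] \<omega>) \<partial>M) = (\<integral>\<^sup>+\<omega>. (\<integral>\<^sup>+y. u y \<partial>p (X [] \<omega>)) \<partial>M)"
      using markov_chain_step[OF M chain kernel _ u, of "\<lambda>_. 1" "ray [b]" 0] ray[of 0 "[b]"] ray[of 1 "[b]"]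
      by simp
    also have "\<dots> = (\<integral>\<^sup>+\<omega>. (\<integral>\<^sup>+y. u y \<partial>p x) \<partial>M)"
      using root by (intro nn_integral_cong_AE) auto
    finally show ?thesis by (simp add: emeasure_space_1)
  qed
  define g where "g y = inverse (1 + total_progeny y)" for y
  have g[measurable]: "g \<in> borel_measurable S"
    unfolding g_def[abs_def] by measurable
  have g_le1: "g y \<le> 1" for y
    unfolding g_def by (rule inverse_one_plus_ennreal)
  have g_progeny: "g y * total_progeny y \<le> 1" for y
    unfolding g_def by (rule inverse_one_plus_ennreal)
  define W where "W \<omega> = g (X [False] \<omega>) * g (X [True] \<omega>)" for \<omega>
  have [measurable]: "W \<in> borel_measurable M" unfolding W_def[abs_def] by measurable
  have W_le: "W \<omega> \<le> g (X [b] \<omega>)" for b \<omega>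
    unfolding W_def using g_le1 mult_left_mono[OF g_le1] mult_right_mono[OF g_le1]
    by (cases b) (metis mult_1_left zero_le, metis mult_1_right zero_le)
  have g_pos: "AE \<omega> in M. g (X [b] \<omega>) \<noteq> 0" for b
  proof -
    have "emeasure (p x) {y\<in>space (p x). total_progeny y = \<infinity>} = 0"
      using fin by (intro emeasure_eq_0_AE) auto
    then have "(\<integral>\<^sup>+y. indicator {y\<in>space S. total_progeny y = \<infinity>} y \<partial>p x) = 0"
      by (subst nn_integral_indicator) (simp_all add: space_kernel[OF x] sets_kernel[OF x])
    then have "(\<integral>\<^sup>+\<omega>. indicator {y\<in>space S. total_progeny y = \<infinity>} (X [b] \<omega>) \<partial>M) = 0"
      by (subst child) auto
    then have "AE \<omega> in M. indicator {y\<in>space S. total_progeny y = \<infinity>} (X [b] \<omega>) = (0::ennreal)"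
      by (subst (asm) nn_integral_0_iff_AE) auto
    with AE_space show ?thesis
      by eventually_elim (auto simp: g_def Xs split: split_indicator_asm)
  qed
  let ?w = "\<lambda>\<omega> v. ennreal (survival_weight a (\<lambda>u. lam (X u \<omega>)) v)"
  have [measurable]: "(\<lambda>\<omega>. ?w \<omega> v) \<in> borel_measurable M" for v
    unfolding survival_weight_def by measurable
  have vertex: "(\<integral>\<^sup>+\<omega>. W \<omega> * ?w \<omega> v \<partial>M) \<le> (\<integral>\<^sup>+y. g y * ennreal (survival (Suc n) y) \<partial>p x)"
    if v: "length v = Suc n" for v n
  proof -
    let ?Y = "\<lambda>k. X (path_vertex (ray v) k)"
    let ?h = "\<lambda>y. lam y / (a + lam y)"
    have Y: "?Y j = X (take j v)" if "j \<le> Suc n" for j using ray[of j v] v that by simp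
    have Y1: "?Y 1 = X [hd v]" using Y[of 1] v by (cases v) auto
    have prod_le: "W \<omega> * ?w \<omega> v \<le> g (?Y 1 \<omega>) * (\<Prod>j<Suc n. ennreal (?h (?Y (1 + j) \<omega>)))"
      if \<omega>: "\<omega> \<in> space M" for \<omega>
    proof -
      have "survival_weight a (\<lambda>u. lam (X u \<omega>)) v = (\<Prod>j<Suc (Suc n). ?h (?Y j \<omega>))"
        unfolding survival_weight_def v
        by (rule prod.cong) (auto simp: Y)
      also have "\<dots> = ?h (?Y 0 \<omega>) * (\<Prod>j<Suc n. ?h (?Y (1 + j) \<omega>))"
        by (subst prod.lessThan_Suc_shift) simp
      \<comment> \<open>The factor of the root is at most \<open>1\<close>; without it the product starts at the child.\<close>
      also have "\<dots> \<le> (\<Prod>j<Suc n. ?h (?Y (1 + j) \<omega>))"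
        using h01 Xs[OF \<omega>] by (intro mult_left_le_one_le prod_nonneg) auto
      finally have "?w \<omega> v \<le> (\<Prod>j<Suc n. ennreal (?h (?Y (1 + j) \<omega>)))"
        using h01 Xs[OF \<omega>] by (subst prod_ennreal) (auto intro: ennreal_leI)
      then show ?thesis
        unfolding Y1 by (intro mult_mono W_le) auto
    qed
    have YH: "?Y 1 \<in> history M S ?Y 1 \<rightarrow>\<^sub>M S"
      by (rule measurable_history) auto
    have "(\<integral>\<^sup>+\<omega>. W \<omega> * ?w \<omega> v \<partial>M) \<le> (\<integral>\<^sup>+\<omega>. g (?Y 1 \<omega>) * (\<Prod>j<Suc n. ennreal (?h (?Y (1 + j) \<omega>))) \<partial>M)"
      by (rule nn_integral_mono) (rule prod_le)
    also have "\<dots> = (\<integral>\<^sup>+\<omega>. g (?Y 1 \<omega>) * ennreal (survival (Suc n) (?Y 1 \<omega>)) \<partial>M)"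
      by (rule expectation_path_product[OF M chain]) (rule measurable_compose[OF YH g])
    also have "\<dots> = (\<integral>\<^sup>+y. g y * ennreal (survival (Suc n) y) \<partial>p x)"
      unfolding Y1 by (rule child) measurable
    finally show ?thesis .
  qed
  have card_level: "card {v :: vertex. length v = n} = 2 ^ n" for n
    using card_lists_length_eq[of "UNIV :: bool set" n] by simp
  let ?\<Phi> = "\<lambda>\<omega>. \<Sum>n. \<Sum>v | length v = Suc n. ?w \<omega> v"
  have "(\<integral>\<^sup>+\<omega>. W \<omega> * ?\<Phi> \<omega> \<partial>M) = (\<integral>\<^sup>+\<omega>. (\<Sum>n. \<Sum>v | length v = Suc n. W \<omega> * ?w \<omega> v) \<partial>M)"
    by (simp only: sum_distrib_left[symmetric] ennreal_suminf_cmult)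
  also have "\<dots> = (\<Sum>n. \<Sum>v | length v = Suc n. \<integral>\<^sup>+\<omega>. W \<omega> * ?w \<omega> v \<partial>M)"
    by (subst nn_integral_suminf) (simp_all add: nn_integral_sum)
  also have "\<dots> \<le> (\<Sum>n. \<Sum>v | length (v :: vertex) = Suc n. \<integral>\<^sup>+y. g y * ennreal (survival (Suc n) y) \<partial>p x)"
    by (intro suminf_le sum_mono vertex) auto
  also have "\<dots> = (\<Sum>n. \<integral>\<^sup>+y. g y * ennreal (2 ^ Suc n * survival (Suc n) y) \<partial>p x)"
  proof (rule arg_cong[of _ _ suminf], rule ext)
    fix n
    have [measurable]: "g \<in> borel_measurable (p x)" "survival k \<in> borel_measurable (p x)" for k
      by (simp_all add: measurable_cong_sets[OF sets_kernel[OF x] refl])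
    have "(\<Sum>v | length (v :: vertex) = Suc n. \<integral>\<^sup>+y. g y * ennreal (survival (Suc n) y) \<partial>p x)
        = ennreal (2 ^ Suc n) * (\<integral>\<^sup>+y. g y * ennreal (survival (Suc n) y) \<partial>p x)"
      by (simp only: sum_constant card_level ennreal_of_nat_eq_real_of_nat of_nat_power of_nat_numeral)
    also have "\<dots> = (\<integral>\<^sup>+y. ennreal (2 ^ Suc n) * (g y * ennreal (survival (Suc n) y)) \<partial>p x)"
      by (rule nn_integral_cmult[symmetric]) measurable
    also have "\<dots> = (\<integral>\<^sup>+y. g y * ennreal (2 ^ Suc n * survival (Suc n) y) \<partial>p x)"
      by (intro nn_integral_cong) (simp only: ennreal_mult' zero_le_power zero_le_numeral mult.left_commute)
    finally show "(\<Sum>v | length (v :: vertex) = Suc n. \<integral>\<^sup>+y. g y * ennreal (survival (Suc n) y) \<partial>p x)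
        = (\<integral>\<^sup>+y. g y * ennreal (2 ^ Suc n * survival (Suc n) y) \<partial>p x)" .
  qed
  also have "\<dots> = (\<integral>\<^sup>+y. g y * total_progeny y \<partial>p x)"
    unfolding total_progeny_def ennreal_suminf_cmult[symmetric]
    by (rule nn_integral_suminf[symmetric]) (simp add: measurable_cong_sets[OF sets_kernel[OF x] refl])
  also have "\<dots> \<le> (\<integral>\<^sup>+y. 1 \<partial>p x)"
    by (rule nn_integral_mono) (rule g_progeny)
  finally have "(\<integral>\<^sup>+\<omega>. W \<omega> * ?\<Phi> \<omega> \<partial>M) \<noteq> \<infinity>"
    by (auto simp: P.emeasure_space_1 top_unique)
  then have "AE \<omega> in M. W \<omega> * ?\<Phi> \<omega> \<noteq> \<infinity>"
    by (intro nn_integral_noteq_infinite) auto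
  with g_pos[of False] g_pos[of True] have "AE \<omega> in M. ?\<Phi> \<omega> \<noteq> \<infinity>"
    by eventually_elim (auto simp: W_def ennreal_mult_eq_top_iff)
  then show ?thesis
    by (rule non_explosive_if_summable_survival_weights[OF dsy a_pos])
qed

text \<open>
  By Tonelli the \<open>\<gamma>\<close>-mean of \<open>total_progeny\<close> is the series with terms
  \<open>2\<^sup>n \<langle>1, (T\<^sub>a)\<^sup>n 1\<rangle>\<close>, and these are eventually at most those of a convergent geometric series.
\<close>

lemma AE_total_progeny_finite:
  assumes "prob_space \<gamma>" and sets[measurable_cong]: "sets \<gamma> = sets S"
    and spectral: "limsup (\<lambda>n. ereal (root n (L2_inner \<gamma> (\<lambda>_. 1) (survival n)))) < ereal (1/2)"
  shows "AE y in \<gamma>. total_progeny y \<noteq> \<infinity>"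
proof -
  interpret prob_space \<gamma> by fact
  have sp: "space \<gamma> = space S" by (rule sets_eq_imp_space_eq) fact
  have [measurable]: "survival n \<in> borel_measurable \<gamma>" for n
    by (simp add: measurable_cong_sets[OF sets refl])
  have int: "(\<integral>\<^sup>+y. ennreal (survival n y) \<partial>\<gamma>) = ennreal (L2_inner \<gamma> (\<lambda>_. 1) (survival n))" for n
    unfolding L2_inner_def using survival_bounds sp
    by (subst nn_integral_eq_integral)
      (auto intro!: integrable_const_bound[of _ 1] AE_I2)
  have pos: "0 \<le> L2_inner \<gamma> (\<lambda>_. 1) (survival n)" for n
    unfolding L2_inner_def using survival_bounds sp by (intro integral_nonneg_AE AE_I2) auto
  have "(\<integral>\<^sup>+y. total_progeny y \<partial>\<gamma>) = (\<Sum>n. \<integral>\<^sup>+y. ennreal (2 ^ Suc n * survival (Suc n) y) \<partial>\<gamma>)"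
    unfolding total_progeny_def by (rule nn_integral_suminf) measurable
  also have "\<dots> = (\<Sum>n. ennreal (2 ^ Suc n * L2_inner \<gamma> (\<lambda>_. 1) (survival (Suc n))))"
    by (simp only: ennreal_mult' zero_le_power zero_le_numeral)
      (simp add: nn_integral_cmult int)
  also have "\<dots> \<noteq> \<infinity>"
    using summable_progeny_if_root_less_half[OF pos spectral,
        THEN summable_Suc_iff[of "\<lambda>n. 2 ^ n * L2_inner \<gamma> (\<lambda>_. 1) (survival n)", THEN iffD2]] pos
    by (subst suminf_ennreal2) auto
  finally show ?thesis by (intro nn_integral_noteq_infinite) auto
qed

end

section \<open>Non-explosion under the spectral condition\<close>

theorem theorem3p3:
  fixes S \<gamma> :: "'a measure"
    and p :: "'a \<Rightarrow> 'a measure"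
    and lam :: "'a \<Rightarrow> real"
    and a :: real
  assumes kernel: "p \<in> S \<rightarrow>\<^sub>M prob_algebra S"
    and lam_measurable: "lam \<in> borel_measurable S"
    and lam_pos: "\<And>x. x \<in> space S \<Longrightarrow> 0 < lam x"
    and gamma_prob: "prob_space \<gamma>"
    and gamma_sets: "sets \<gamma> = sets S"
    and invariant: "invariant_measure \<gamma> p"
    and reversible: "time_reversible S \<gamma> p"
    and a_pos: "0 < a"
    and spectral: "limsup (\<lambda>n. ereal (root n
        (L2_inner \<gamma> (\<lambda>_. 1) ((T_op p lam a ^^ n) (\<lambda>_. 1))))) < ereal (1/2)"
  shows "(AE x in \<gamma>. \<forall>(M :: 'w measure) X T.
            dsy_cascade_type_M M S p lam X T \<longrightarrow> (AE \<omega> in M. X [] \<omega> = x) \<longrightarrow>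
            non_explosive M (\<lambda>v \<omega>. lam (X v \<omega>)) T)
       \<and> (\<forall>x0\<in>space S. absolutely_continuous \<gamma> (p x0) \<longrightarrow>
            (\<forall>(M :: 'w measure) X T.
               dsy_cascade_type_M M S p lam X T \<longrightarrow> (AE \<omega> in M. X [] \<omega> = x0) \<longrightarrow>
               non_explosive M (\<lambda>v \<omega>. lam (X v \<omega>)) T))"
proof -
  interpret killed_kernel S p lam a by unfold_locales fact+
  have sp: "space \<gamma> = space S" by (rule sets_eq_imp_space_eq) fact
  have fin: "AE y in \<gamma>. total_progeny y \<noteq> \<infinity>"
    by (rule AE_total_progeny_finite[OF gamma_prob gamma_sets]) (use spectral in \<open>simp add: survival_def\<close>)
  have p: "p \<in> \<gamma> \<rightarrow>\<^sub>M subprob_algebra S"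
    using kernel_subprob by (simp add: measurable_cong_sets[OF gamma_sets refl])
  \<comment> \<open>By invariance a \<open>\<gamma>\<close>-null set is \<open>p x\<close>-null for \<open>\<gamma>\<close>-almost every \<open>x\<close>.\<close>
  have "AE y in \<gamma> \<bind> p. total_progeny y \<noteq> \<infinity>"
    using fin by (simp only: invariant[unfolded invariant_measure_def])
  then have "AE x in \<gamma>. AE y in p x. total_progeny y \<noteq> \<infinity>"
    by (subst (asm) AE_bind[OF p]) auto
  with AE_space have "AE x in \<gamma>. \<forall>(M :: 'w measure) X T.
      dsy_cascade_type_M M S p lam X T \<longrightarrow> (AE \<omega> in M. X [] \<omega> = x) \<longrightarrow>
      non_explosive M (\<lambda>v \<omega>. lam (X v \<omega>)) T"
    by eventually_elim (auto simp: sp intro: non_explosive_if_total_progeny_finite)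
  moreover have "non_explosive M (\<lambda>v \<omega>. lam (X v \<omega>)) T"
    if x0: "x0 \<in> space S" and ac: "absolutely_continuous \<gamma> (p x0)"
      and casc: "dsy_cascade_type_M M S p lam X T" "AE \<omega> in M. X [] \<omega> = x0"
    for x0 X T and M :: "'w measure"
    using sets_kernel[OF x0] gamma_sets
    by (intro non_explosive_if_total_progeny_finite[OF casc(1) x0 casc(2)]
        absolutely_continuous_AE[OF _ ac fin]) simp
  ultimately show ?thesis by blast
qed

end
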